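(* Let $\alpha,\beta\in\mathbb{C}$ with $\alpha\notin\mathbb{Z}$. Let $L$ be an arbitrary complex Leibniz algebra whose corresponding Lie algebra $L/\mathcal{I}$ is the Witt algebra $\mathcal{W}$ and whose ideal $\mathcal{I}$, as a right $\mathcal{W}$-module, is $V(\alpha,\beta)$. More precisely, $L=\mathcal{W}\oplus\mathcal{I}$ as a vector space with $\mathcal{I}=V(\alpha,\beta)$, and the product $[\cdot,\cdot]$ of $L$ satisfies $$[v,x]=v\star x\quad (v\in V(\alpha,\beta),\ x\in\mathcal{W}),\qquad [\mathcal{W},V(\alpha,\beta)]=[V(\alpha,\beta),V(\alpha,\beta)]=0 ,$$ where $\star$ is the right $\mathcal{W}$-module action on $V(\alpha,\beta)$ (for $x,y\in\mathcal{W}$, the product of $x$ and $y$ in $L$ is only known to agree modulo $\mathcal{I}$ with their product in the Witt algebra). Then there exists a basis $\{d_i, v(i) \mid i\in\mathbb{Z}\}$ of $L$ in which the table of multiplications of $L$ is $$[v(k),d_i]=(k+\alpha+\beta i)\,v(i+k),\qquad [d_i,d_j]=(i-j)\,d_{i+j},\qquad i,j,k\in\mathbb{Z},$$ all other products of basis elements (that is, $[d_i,v(k)]$ and $[v(k),v(l)]$) being zero.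
   Context: All algebras are over the field $\mathbb{C}$ of complex numbers; bases are algebraic (Hamel) bases, so all linear combinations are finite. A (right) Leibniz algebra is a vector space $L$ with a bilinear product $[\cdot,\cdot]$ satisfying $[x,[y,z]]=[[x,y],z]-[[x,z],y]$ for all $x,y,z\in L$. Its Leibniz kernel is the ideal $\mathcal{I}$ generated by the squares of elements, $\mathcal{I}=\langle [x,x]\mid x\in L\rangle$; it is contained in the right annihilator of $L$ (i.e. $[L,\mathcal{I}]=0$), and $L/\mathcal{I}$ is a Lie algebra, called the corresponding Lie algebra of $L$. The map $\mathcal{I}\times L/\mathcal{I}\to\mathcal{I}$, $(v,\overline{x})\mapsto[v,x]$, makes $\mathcal{I}$ a right $L/\mathcal{I}$-module. The Witt algebra $\mathcal{W}$ is the Lie algebra of derivations of $\mathbb{C}[z,z^{-1}]$; it has basis $\{d_j\mid j\in\mathbb{Z}\}$, $d_j=-z^{j+1}\frac{d}{dz}$, with $[d_m,d_n]=(m-n)d_{m+n}$ for $m,n\in\mathbb{Z}$. $V(\alpha,\beta)$ is the vector space with basis $\{v(n)\mid n\in\mathbb{Z}\}$ and right $\mathcal{W}$-module structure $v(n)\star d_m=(\alpha+n+\beta m)\,v(n+m)$ for $m,n\in\mathbb{Z}$. In tables of multiplication, omitted products are zero. *)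

theory Defs
  imports Complex_Main "HOL-Library.Poly_Mapping"
begin

definition basis_family :: "(complex \<Rightarrow> 'b::ab_group_add \<Rightarrow> 'b) \<Rightarrow> ('i \<Rightarrow> 'b) \<Rightarrow> bool" where
  "basis_family s b \<longleftrightarrow> inj b \<and> \<not> module.dependent s (range b) \<and> module.span s (range b) = UNIV"

locale leibniz_algebra = vector_space scale
  for scale :: "complex \<Rightarrow> 'a::ab_group_add \<Rightarrow> 'a" +
  fixes br :: "'a \<Rightarrow> 'a \<Rightarrow> 'a"
  assumes linear_br_left: "Vector_Spaces.linear scale scale (\<lambda>x. br x y)"
    and linear_br_right: "Vector_Spaces.linear scale scale (\<lambda>y. br x y)"
    and leibniz_identity: "br x (br y z) = br (br x y) z - br (br x z) y"

definition leibniz_ideal :: "(complex \<Rightarrow> 'a::ab_group_add \<Rightarrow> 'a) \<Rightarrow> ('a \<Rightarrow> 'a \<Rightarrow> 'a) \<Rightarrow> 'a set \<Rightarrow> bool" where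
  "leibniz_ideal scale br J \<longleftrightarrow>
     module.subspace scale J \<and> (\<forall>a\<in>J. \<forall>x. br a x \<in> J \<and> br x a \<in> J)"

definition leibniz_kernel :: "(complex \<Rightarrow> 'a::ab_group_add \<Rightarrow> 'a) \<Rightarrow> ('a \<Rightarrow> 'a \<Rightarrow> 'a) \<Rightarrow> 'a set" where
  "leibniz_kernel scale br = leibniz_ideal scale br hull range (\<lambda>x. br x x)"

text \<open>
  The type \<^typ>\<open>int \<Rightarrow>\<^sub>0 complex\<close> is used twice: with its convolution product it is the
  algebra of Laurent polynomials, \<^term>\<open>Poly_Mapping.single n 1\<close> being the \<open>n\<close>-th power of \<open>z\<close>;
  as a mere vector space it has the basis \<^term>\<open>\<lambda>n. Poly_Mapping.single n 1\<close> indexed by the integers.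
\<close>

type_synonym laurent = "int \<Rightarrow>\<^sub>0 complex"

definition lscale :: "complex \<Rightarrow> laurent \<Rightarrow> laurent" where
  "lscale c f = Poly_Mapping.map ((*) c) f"

lemma lookup_lscale [simp]: "Poly_Mapping.lookup (lscale c f) n = c * Poly_Mapping.lookup f n"
  by (simp add: lscale_def Poly_Mapping.map.rep_eq when_def)

interpretation lau: vector_space lscale
  by unfold_locales (auto intro!: poly_mapping_eqI simp: lookup_add algebra_simps)

lemma lscale_conv_mult: "lscale c f = Poly_Mapping.single 0 c * f"
  by (simp add: lscale_def mult_map_scale_conv_mult)

lemma lscale_mult: "lscale c f * g = lscale c (f * g)" "f * lscale c g = lscale c (f * g)"
  by (simp_all add: lscale_conv_mult algebra_simps)

lemma single_one_eq_iff: "Poly_Mapping.single m (1::complex) = Poly_Mapping.single n 1 \<longleftrightarrow> m = n"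
  by (metis lookup_single_eq lookup_single_not_eq zero_neq_one)

lemma lscale_single [simp]: "lscale c (Poly_Mapping.single n a) = Poly_Mapping.single n (c * a)"
  by (simp add: lscale_def)

lemma laurent_expand: "f = (\<Sum>n\<in>Poly_Mapping.keys f. Poly_Mapping.single n (Poly_Mapping.lookup f n))" for f :: laurent
proof (rule poly_mapping_eqI)
  fix k
  show "Poly_Mapping.lookup f k = Poly_Mapping.lookup (\<Sum>n\<in>Poly_Mapping.keys f. Poly_Mapping.single n (Poly_Mapping.lookup f n)) k"
    by (auto simp: lookup_sum lookup_single when_def in_keys_iff)
qed

lemma laurent_induct [case_names add single]:
  fixes f :: laurent
  assumes "\<And>f g. P f \<Longrightarrow> P g \<Longrightarrow> P (f + g)" and "\<And>n c. P (Poly_Mapping.single n c)"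
  shows "P f"
proof -
  have "P (\<Sum>n\<in>A. Poly_Mapping.single n (Poly_Mapping.lookup f n))" if "finite A" for A
    using that
  proof induction
    case empty
    show ?case using assms(2)[of 0 0] by simp
  qed (use assms in auto)
  from this[of "Poly_Mapping.keys f"] show ?thesis using laurent_expand[of f] by simp
qed

lift_definition ddz :: "laurent \<Rightarrow> laurent" is "\<lambda>f n. of_int (n + 1) * f (n + 1)"
proof -
  fix f :: "int \<Rightarrow> complex"
  assume "finite {n. f n \<noteq> 0}"
  then have "finite ((\<lambda>n. n - 1) ` {n. f n \<noteq> 0})" by simp
  then show "finite {n. of_int (n + 1) * f (n + 1) \<noteq> 0}"
    by (rule rev_finite_subset) (auto intro!: image_eqI[where x = "_ + 1"])
qed

lemma lookup_ddz [simp]: "Poly_Mapping.lookup (ddz f) n = of_int (n + 1) * Poly_Mapping.lookup f (n + 1)"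
  by transfer simp

lemma ddz_add: "ddz (f + g) = ddz f + ddz g"
  by (rule poly_mapping_eqI) (simp add: lookup_add algebra_simps)

lemma ddz_lscale: "ddz (lscale c f) = lscale c (ddz f)"
  by (rule poly_mapping_eqI) (simp add: algebra_simps)

lemma ddz_single: "ddz (Poly_Mapping.single n c) = Poly_Mapping.single (n - 1) (of_int n * c)"
  by (rule poly_mapping_eqI) (auto simp: lookup_single when_def)

lemma ddz_mult: "ddz (f * g) = ddz f * g + f * ddz g"
proof (induction f rule: laurent_induct)
  case (single n c)
  show ?case
    by (induction g rule: laurent_induct)
      (auto simp: ddz_add ddz_single mult_single algebra_simps simp flip: single_add)
qed (simp add: ddz_add algebra_simps)

definition derivation :: "(laurent \<Rightarrow> laurent) \<Rightarrow> bool" where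
  "derivation D \<longleftrightarrow> Vector_Spaces.linear lscale lscale D \<and> (\<forall>f g. D (f * g) = D f * g + f * D g)"

lemma derivation_iff:
  "derivation D \<longleftrightarrow> (\<forall>f g. D (f + g) = D f + D g) \<and> (\<forall>c f. D (lscale c f) = lscale c (D f)) \<and>
     (\<forall>f g. D (f * g) = D f * g + f * D g)"
  unfolding derivation_def
  by (auto simp: Vector_Spaces.linear_iff lau.vector_space_axioms)

typedef witt = "{D. derivation D}" morphisms witt_apply Abs_witt
proof
  show "(\<lambda>_. 0) \<in> {D. derivation D}" by (simp add: derivation_iff)
qed

setup_lifting type_definition_witt

instantiation witt :: ab_group_add
begin

lift_definition zero_witt :: witt is "\<lambda>_. 0"
  by (simp add: derivation_iff)
lift_definition plus_witt :: "witt \<Rightarrow> witt \<Rightarrow> witt" is "\<lambda>D E f. D f + E f"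
  by (simp add: derivation_iff lau.scale_right_distrib algebra_simps)
lift_definition uminus_witt :: "witt \<Rightarrow> witt" is "\<lambda>D f. - D f"
  by (simp add: derivation_iff algebra_simps)
lift_definition minus_witt :: "witt \<Rightarrow> witt \<Rightarrow> witt" is "\<lambda>D E f. D f - E f"
  by (simp add: derivation_iff lau.scale_right_diff_distrib algebra_simps)

instance
  by (standard; transfer; simp add: algebra_simps)

end

lift_definition witt_scale :: "complex \<Rightarrow> witt \<Rightarrow> witt" is "\<lambda>c D f. lscale c (D f)"
  by (simp add: derivation_iff lau.scale_right_distrib lau.scale_left_commute lscale_mult)

lift_definition witt_bracket :: "witt \<Rightarrow> witt \<Rightarrow> witt" is "\<lambda>D E f. D (E f) - E (D f)"
  by (simp add: derivation_iff lau.scale_right_diff_distrib algebra_simps)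

lift_definition witt_d :: "int \<Rightarrow> witt" is "\<lambda>j f. - (Poly_Mapping.single (j + 1) 1 * ddz f)"
  by (simp add: derivation_iff ddz_add ddz_lscale ddz_mult lscale_mult algebra_simps)

text \<open>
  The coordinates of a derivation with respect to \<^const>\<open>witt_d\<close>: if \<open>D\<close> is the sum of the
  \<open>c\<^sub>j d\<^sub>j\<close> then \<open>D z\<close> is minus the sum of the \<open>c\<^sub>j z\<^bsup>j+1\<^esup>\<close> (cf. \<open>witt_expand\<close> below).
\<close>

definition witt_coeffs :: "witt \<Rightarrow> laurent" where
  "witt_coeffs D = - (Poly_Mapping.single (- 1) 1 * witt_apply D (Poly_Mapping.single 1 1))"

interpretation witt: vector_space witt_scale
  by (unfold_locales; transfer; auto simp: algebra_simps)

lemma witt_coeffs_d: "witt_coeffs (witt_d j) = Poly_Mapping.single j 1"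
  by (simp add: witt_coeffs_def witt_d.rep_eq ddz_single mult_single)

lemma witt_coeffs_add: "witt_coeffs (D + E) = witt_coeffs D + witt_coeffs E"
  by (simp add: witt_coeffs_def plus_witt.rep_eq algebra_simps)

lemma witt_coeffs_scale: "witt_coeffs (witt_scale c D) = lscale c (witt_coeffs D)"
  by (simp add: witt_coeffs_def witt_scale.rep_eq lscale_conv_mult algebra_simps)

lemma linear_witt_coeffs: "Vector_Spaces.linear witt_scale lscale witt_coeffs"
  by (simp add: Vector_Spaces.linear_iff witt.vector_space_axioms lau.vector_space_axioms
      witt_coeffs_add witt_coeffs_scale)

lemma derivation_eq_ddz:
  assumes "derivation D"
  shows "D f = D (Poly_Mapping.single 1 1) * ddz f"
proof -
  let ?X = "\<lambda>n. Poly_Mapping.single n 1 :: laurent"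
  have add: "D (f + g) = D f + D g" and sc: "D (lscale c f) = lscale c (D f)"
    and mult: "D (f * g) = D f * g + f * D g" for c f g
    using assms by (auto simp: derivation_iff)
  have "D 1 = 0" using mult[of 1 1] by simp
  have up: "D (?X (n + 1)) = D (?X n) * ?X 1 + ?X n * D (?X 1)" for n
    using mult[of "?X n" "?X 1"] by (simp add: mult_single)
  have pow: "D (?X n) = D (?X 1) * ddz (?X n)" for n
  proof (induction n rule: int_induct[where k = 0])
    case base
    have "ddz (?X 0) = 0" by (simp add: ddz_single del: single_one)
    then show ?case using \<open>D 1 = 0\<close> by simp
  next
    case (step1 i)
    have "Poly_Mapping.single (i - 1) (of_int i) * ?X 1 + ?X i
        = (Poly_Mapping.single i (of_int (i + 1)) :: laurent)"
      by (simp add: mult_single flip: single_add)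
    then have "ddz (?X (i + 1)) = ddz (?X i) * ?X 1 + ?X i"
      by (simp add: ddz_single)
    then show ?case
      unfolding up[of i] step1(2) by (simp add: algebra_simps)
  next
    case (step2 i)
    have eq: "D (?X i) = D (?X (i - 1)) * ?X 1 + ?X (i - 1) * D (?X 1)"
      using up[of "i - 1"] by simp
    have "D (?X (i - 1)) = D (?X (i - 1)) * (?X 1 * ?X (-1))" by (simp add: mult_single)
    also have "\<dots> = (D (?X i) - ?X (i - 1) * D (?X 1)) * ?X (-1)"
      by (simp add: eq algebra_simps)
    also have "\<dots> = D (?X 1) * ((ddz (?X i) - ?X (i - 1)) * ?X (-1))"
      by (simp add: step2(2) algebra_simps)
    also have "(ddz (?X i) - ?X (i - 1)) * ?X (-1) = ddz (?X (i - 1))"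
      by (simp add: ddz_single mult_single left_diff_distrib algebra_simps flip: single_diff)
    finally show ?case .
  qed
  show ?thesis
  proof (induction f rule: laurent_induct)
    case (single n c)
    have "D (lscale c (?X n)) = D (?X 1) * ddz (lscale c (?X n))"
      unfolding sc pow[of n] ddz_lscale by (simp add: lscale_conv_mult algebra_simps)
    then show ?case by simp
  qed (simp add: add ddz_add algebra_simps)
qed

lemma witt_eqI:
  assumes "witt_coeffs D = witt_coeffs E"
  shows "D = E"
proof -
  have "Poly_Mapping.single 1 1 * (- witt_coeffs F) = witt_apply F (Poly_Mapping.single 1 1)" for F
    by (simp add: witt_coeffs_def mult_single flip: mult.assoc)
  from this[of D] this[of E]
  have z: "witt_apply D (Poly_Mapping.single 1 1) = witt_apply E (Poly_Mapping.single 1 1)"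
    unfolding assms by simp
  have "witt_apply D = witt_apply E"
  proof
    fix f
    have "derivation (witt_apply D)" "derivation (witt_apply E)"
      using witt_apply[of D] witt_apply[of E] by simp_all
    from this[THEN derivation_eq_ddz, of f] show "witt_apply D f = witt_apply E f"
      unfolding z by (rule trans[OF _ sym])
  qed
  then show ?thesis by (simp add: witt_apply_inject)
qed

lemma witt_expand:
  "D = (\<Sum>j\<in>Poly_Mapping.keys (witt_coeffs D). witt_scale (Poly_Mapping.lookup (witt_coeffs D) j) (witt_d j))"
proof (rule witt_eqI)
  interpret c: Vector_Spaces.linear witt_scale lscale witt_coeffs by (rule linear_witt_coeffs)
  show "witt_coeffs D = witt_coeffs (\<Sum>j\<in>Poly_Mapping.keys (witt_coeffs D). witt_scale (Poly_Mapping.lookup (witt_coeffs D) j) (witt_d j))"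
    by (subst laurent_expand) (simp add: c.sum c.scale witt_coeffs_d)
qed

lemma basis_family_single: "basis_family lscale (\<lambda>n. Poly_Mapping.single n 1)"
proof -
  let ?X = "\<lambda>n. Poly_Mapping.single n 1 :: laurent"
  have inj: "inj ?X" by (simp add: inj_def single_one_eq_iff)
  have "f \<in> lau.span (range ?X)" for f
    by (subst laurent_expand)
      (metis (no_types, lifting) lau.span_base lau.span_scale lau.span_sum lscale_single mult.right_neutral rangeI)
  moreover have "lau.independent (range ?X)"
    unfolding lau.independent_explicit_module
  proof (intro allI impI)
    fix t u w
    assume t: "finite t" "t \<subseteq> range ?X" and 0: "(\<Sum>v\<in>t. lscale (u v) v) = 0" and w: "w \<in> t"
    obtain n where n: "w = ?X n" using t w by auto
    have "0 = Poly_Mapping.lookup (\<Sum>v\<in>t. lscale (u v) v) n" using 0 by simp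
    also have "\<dots> = (\<Sum>v\<in>t. u v * Poly_Mapping.lookup v n)" by (simp add: lookup_sum)
    also have "\<dots> = (\<Sum>v\<in>{w}. u v * Poly_Mapping.lookup v n)"
      using t w n
      by (intro sum.mono_neutral_right)
        (auto simp: lookup_single when_def dest!: subsetD[OF t(2)] split: if_splits)
    also have "\<dots> = u w" by (simp add: n)
    finally show "u w = 0" by simp
  qed
  ultimately show ?thesis using inj by (auto simp: basis_family_def)
qed

lemma basis_family_witt_d: "basis_family witt_scale witt_d"
proof -
  interpret c: Vector_Spaces.linear witt_scale lscale witt_coeffs by (rule linear_witt_coeffs)
  have "witt.independent (range witt_d)"
    unfolding witt.independent_explicit_module
  proof (intro allI impI)
    fix t u w
    assume t: "finite t" "t \<subseteq> range witt_d" and 0: "(\<Sum>v\<in>t. witt_scale (u v) v) = 0" and w: "w \<in> t"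
    obtain n where n: "w = witt_d n" using t w by auto
    have "0 = Poly_Mapping.lookup (witt_coeffs (\<Sum>v\<in>t. witt_scale (u v) v)) n" using 0 c.zero by simp
    also have "\<dots> = (\<Sum>v\<in>t. u v * Poly_Mapping.lookup (witt_coeffs v) n)"
      by (simp add: lookup_sum c.sum c.scale)
    also have "\<dots> = (\<Sum>v\<in>{w}. u v * Poly_Mapping.lookup (witt_coeffs v) n)"
      using t w n
      by (intro sum.mono_neutral_right)
        (auto simp: witt_coeffs_d lookup_single when_def dest!: subsetD[OF t(2)] split: if_splits)
    also have "\<dots> = u w" by (simp add: n witt_coeffs_d)
    finally show "u w = 0" by simp
  qed
  moreover have "D \<in> witt.span (range witt_d)" for D
    by (subst witt_expand) (intro witt.span_sum witt.span_scale witt.span_base rangeI)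
  moreover have "inj witt_d"
    by (rule injI) (metis witt_coeffs_d single_one_eq_iff)
  ultimately show ?thesis by (auto simp: basis_family_def)
qed

lemma witt_bracket_d: "witt_bracket (witt_d m) (witt_d n) = witt_scale (of_int (m - n)) (witt_d (m + n))"
proof (rule witt_eqI)
  have "witt_coeffs (witt_bracket (witt_d m) (witt_d n)) = Poly_Mapping.single (m + n) (of_int (m - n))"
    by (simp add: witt_coeffs_def witt_bracket.rep_eq witt_d.rep_eq ddz_single mult_single algebra_simps
        flip: single_add single_diff single_uminus)
  then show "witt_coeffs (witt_bracket (witt_d m) (witt_d n))
      = witt_coeffs (witt_scale (of_int (m - n)) (witt_d (m + n)))"
    by (simp only: witt_coeffs_scale witt_coeffs_d lscale_single mult.right_neutral)
qed

text \<open>The bilinear extension of \<open>v(n) * d\<^sub>m = (\<alpha> + n + \<beta> m) v(n + m)\<close>, where \<open>v(n)\<close> is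
  \<^term>\<open>Poly_Mapping.single n 1\<close> and \<open>d\<^sub>m\<close> is \<^term>\<open>witt_d m\<close>.\<close>

type_synonym V_space = "int \<Rightarrow>\<^sub>0 complex"

definition V_action :: "complex \<Rightarrow> complex \<Rightarrow> V_space \<Rightarrow> witt \<Rightarrow> V_space" where
  "V_action \<alpha> \<beta> v D = (\<Sum>n\<in>Poly_Mapping.keys v. \<Sum>m\<in>Poly_Mapping.keys (witt_coeffs D).
     Poly_Mapping.single (n + m)
       (Poly_Mapping.lookup v n * Poly_Mapping.lookup (witt_coeffs D) m * (\<alpha> + of_int n + \<beta> * of_int m)))"

lemma V_action_superset:
  assumes "finite A" "Poly_Mapping.keys v \<subseteq> A" "finite B" "Poly_Mapping.keys (witt_coeffs D) \<subseteq> B"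
  shows "V_action \<alpha> \<beta> v D = (\<Sum>n\<in>A. \<Sum>m\<in>B. Poly_Mapping.single (n + m)
    (Poly_Mapping.lookup v n * Poly_Mapping.lookup (witt_coeffs D) m * (\<alpha> + of_int n + \<beta> * of_int m)))"
proof -
  have "V_action \<alpha> \<beta> v D = (\<Sum>n\<in>Poly_Mapping.keys v. \<Sum>m\<in>B. Poly_Mapping.single (n + m)
    (Poly_Mapping.lookup v n * Poly_Mapping.lookup (witt_coeffs D) m * (\<alpha> + of_int n + \<beta> * of_int m)))"
    unfolding V_action_def using assms
    by (intro sum.cong sum.mono_neutral_left refl) (auto simp: in_keys_iff)
  also have "\<dots> = (\<Sum>n\<in>A. \<Sum>m\<in>B. Poly_Mapping.single (n + m)
    (Poly_Mapping.lookup v n * Poly_Mapping.lookup (witt_coeffs D) m * (\<alpha> + of_int n + \<beta> * of_int m)))"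
    using assms by (intro sum.mono_neutral_left) (auto simp: in_keys_iff)
  finally show ?thesis .
qed

lemma V_action_basis:
  "V_action \<alpha> \<beta> (Poly_Mapping.single n 1) (witt_d m)
     = lscale (\<alpha> + of_int n + \<beta> * of_int m) (Poly_Mapping.single (n + m) 1)"
  by (simp add: V_action_def witt_coeffs_d)

lemma linear_V_action_left: "Vector_Spaces.linear lscale lscale (\<lambda>v. V_action \<alpha> \<beta> v D)"
proof -
  have "V_action \<alpha> \<beta> (v + w) D = V_action \<alpha> \<beta> v D + V_action \<alpha> \<beta> w D" for v w
    using Poly_Mapping.keys_add[of v w]
    by (simp add: V_action_superset[of "Poly_Mapping.keys v \<union> Poly_Mapping.keys w" _
          "Poly_Mapping.keys (witt_coeffs D)"]
        lookup_add distrib_left distrib_right single_add sum.distrib)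
  moreover have "V_action \<alpha> \<beta> (lscale c v) D = lscale c (V_action \<alpha> \<beta> v D)" for c v
    by (simp add: V_action_superset[of "Poly_Mapping.keys v" _ "Poly_Mapping.keys (witt_coeffs D)"]
        in_keys_iff subset_iff lau.scale_sum_right mult_ac)
  ultimately show ?thesis by (simp add: Vector_Spaces.linear_iff lau.vector_space_axioms)
qed

lemma linear_V_action_right: "Vector_Spaces.linear witt_scale lscale (V_action \<alpha> \<beta> v)"
proof -
  have "V_action \<alpha> \<beta> v (D + E) = V_action \<alpha> \<beta> v D + V_action \<alpha> \<beta> v E" for D E
    using Poly_Mapping.keys_add[of "witt_coeffs D" "witt_coeffs E"]
    by (simp add: V_action_superset[of "Poly_Mapping.keys v" _
          "Poly_Mapping.keys (witt_coeffs D) \<union> Poly_Mapping.keys (witt_coeffs E)"] witt_coeffs_add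
        lookup_add distrib_left distrib_right single_add sum.distrib)
  moreover have "V_action \<alpha> \<beta> v (witt_scale c D) = lscale c (V_action \<alpha> \<beta> v D)" for c D
    by (simp add: V_action_superset[of "Poly_Mapping.keys v" _ "Poly_Mapping.keys (witt_coeffs D)"]
        witt_coeffs_scale in_keys_iff subset_iff lau.scale_sum_right mult_ac)
  ultimately show ?thesis
    by (simp add: Vector_Spaces.linear_iff lau.vector_space_axioms witt.vector_space_axioms)
qed

lemma V_action_module:
  fixes \<alpha> \<beta> :: complex and v :: V_space and D E :: witt
  shows "V_action \<alpha> \<beta> v (witt_bracket D E) = V_action \<alpha> \<beta> (V_action \<alpha> \<beta> v D) E - V_action \<alpha> \<beta> (V_action \<alpha> \<beta> v E) D"
proof -
  interpret l: Vector_Spaces.linear lscale lscale "\<lambda>v. V_action \<alpha> \<beta> v F" for F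
    by (rule linear_V_action_left)
  interpret r: Vector_Spaces.linear witt_scale lscale "V_action \<alpha> \<beta> x" for x
    by (rule linear_V_action_right)
  let ?X = "\<lambda>n. Poly_Mapping.single n 1 :: laurent"
  define P where "P v D E \<longleftrightarrow> V_action \<alpha> \<beta> v (witt_bracket D E)
    = V_action \<alpha> \<beta> (V_action \<alpha> \<beta> v D) E - V_action \<alpha> \<beta> (V_action \<alpha> \<beta> v E) D" for v D E
  have apply_add: "witt_apply D (f + g) = witt_apply D f + witt_apply D g"
    and apply_scale: "witt_apply D (lscale c f) = lscale c (witt_apply D f)" for D c f g
    using witt_apply[of D] by (auto simp: derivation_iff)
  have br_add: "witt_bracket (D + D') E = witt_bracket D E + witt_bracket D' E"
    "witt_bracket D (E + E') = witt_bracket D E + witt_bracket D E'" for D D' E E'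
    by (auto simp: witt_apply_inject[symmetric] fun_eq_iff witt_bracket.rep_eq plus_witt.rep_eq
        apply_add algebra_simps)
  have br_scale: "witt_bracket (witt_scale c D) E = witt_scale c (witt_bracket D E)"
    "witt_bracket D (witt_scale c E) = witt_scale c (witt_bracket D E)" for c D E
    by (auto simp: witt_apply_inject[symmetric] fun_eq_iff witt_bracket.rep_eq witt_scale.rep_eq
        apply_scale lau.scale_right_diff_distrib)
  have span: "D \<in> witt.span (range witt_d)" "v \<in> lau.span (range ?X)" for D v
    using basis_family_witt_d basis_family_single by (auto simp: basis_family_def)
  have basis: "P (?X n) (witt_d k) (witt_d m)" for n k m
    unfolding P_def witt_bracket_d r.scale V_action_basis l.scale
    by (simp add: algebra_simps flip: single_diff)
  have 1: "P (?X n) (witt_d k) E" for n k E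
    using span(1)[of E]
  proof (induction rule: witt.span_induct_alt)
    case base
    show ?case using br_scale(2)[of _ 0 0] by (simp add: P_def r.zero l.zero)
  next
    case (step c x y)
    then show ?case using basis
      by (auto simp: P_def br_add br_scale r.add l.add r.scale l.scale lau.scale_right_diff_distrib)
  qed
  have 2: "P (?X n) D E" for n D E
    using span(1)[of D]
  proof (induction rule: witt.span_induct_alt)
    case base
    show ?case using br_scale(1)[of 0 0 E] by (simp add: P_def r.zero l.zero)
  next
    case (step c x y)
    then show ?case using 1
      by (auto simp: P_def br_add br_scale r.add l.add r.scale l.scale lau.scale_right_diff_distrib)
  qed
  have "P v D E"
    using span(2)[of v]
  proof (induction rule: lau.span_induct_alt)
    case base
    show ?case by (simp add: P_def l.zero)
  next
    case (step c x y)
    then show ?case using 2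
      by (auto simp: P_def l.add l.scale lau.scale_right_diff_distrib)
  qed
  then show ?thesis unfolding P_def .
qed

end

theory Submission
  imports Defs
begin

text \<open>
  As \<open>\<alpha> \<notin> \<int>\<close>, no eigenvalue \<open>\<alpha> + n\<close> of \<open>d\<^sub>0\<close> on \<open>V(\<alpha>, \<beta>)\<close> is an integer,
  so \<open>d\<^sub>0 - k\<close> acts bijectively
  for every integer \<open>k\<close>. Surjectivity allows adding to each \<open>d\<^sub>i\<close> an element of the kernel such that
  \<open>[d\<^sub>i, d\<^sub>0] = i d\<^sub>i\<close> holds exactly. The Leibniz identity for \<open>d\<^sub>a, d\<^sub>i, d\<^sub>0\<close> then says that \<open>d\<^sub>0\<close> acts
  on \<open>[d\<^sub>a, d\<^sub>i] - (a - i) d\<^sub>a\<^sub>+\<^sub>i\<close> as the scalar \<open>a + i\<close>, so this defect vanishes by injectivity.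
\<close>

text \<open>At m = 0 the action shifts no index and the term \<beta> m drops out, so
  \<open>witt_d 0\<close> is diagonal in the basis \<open>single n 1\<close>. Injectivity and
  surjectivity can therefore be checked coefficient by coefficient.\<close>

lemma lookup_V_action_d0:
  "Poly_Mapping.lookup (V_action \<alpha> \<beta> v (witt_d 0)) n = (\<alpha> + of_int n) * Poly_Mapping.lookup v n"
proof -
  interpret l: Vector_Spaces.linear lscale lscale "\<lambda>v. V_action \<alpha> \<beta> v D" for D
    by (rule linear_V_action_left)
  show ?thesis
  proof (induction v rule: laurent_induct)
    case (add f g)
    then show ?case by (simp add: l.add lookup_add algebra_simps)
  next
    case (single m c)
    have "V_action \<alpha> \<beta> (lscale c (Poly_Mapping.single m 1)) (witt_d 0)
        = lscale c (lscale (\<alpha> + of_int m) (Poly_Mapping.single m 1))"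
      by (simp only: l.scale V_action_basis) simp
    then have "V_action \<alpha> \<beta> (Poly_Mapping.single m c) (witt_d 0)
        = Poly_Mapping.single m (c * (\<alpha> + of_int m))"
      by simp
    then show ?case by (simp add: lookup_single when_def)
  qed
qed

lemma V_action_d0_eigenvalue_not_int:
  assumes "\<alpha> \<notin> \<int>" "V_action \<alpha> \<beta> v (witt_d 0) = lscale (of_int k) v"
  shows "v = 0"
proof (rule poly_mapping_eqI)
  fix n
  have "(\<alpha> + of_int n) * Poly_Mapping.lookup v n = of_int k * Poly_Mapping.lookup v n"
    using assms(2) by (simp flip: lookup_V_action_d0[of \<alpha> \<beta>])
  moreover have "\<alpha> + of_int n \<noteq> of_int k"
    using assms(1) by (metis Ints_of_int add_diff_cancel_right' of_int_diff)
  ultimately show "Poly_Mapping.lookup v n = Poly_Mapping.lookup 0 n" by simp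
qed

lemma V_action_d0_minus_int_surj:
  assumes "\<alpha> \<notin> \<int>"
  obtains f where "lscale (of_int k) f - V_action \<alpha> \<beta> f (witt_d 0) = g"
proof -
  have ne: "of_int k - \<alpha> - of_int n \<noteq> 0" for n
    using assms by (metis Ints_of_int eq_iff_diff_eq_0 diff_diff_eq2 diff_add_cancel add.commute of_int_diff)
  \<comment> \<open>Divide each coefficient by the corresponding diagonal entry. Summing over the
    keys of \<open>g\<close> keeps the support finite.\<close>
  define f where "f = (\<Sum>n\<in>Poly_Mapping.keys g.
    Poly_Mapping.single n (Poly_Mapping.lookup g n / (of_int k - \<alpha> - of_int n)))"
  have "Poly_Mapping.lookup f n = Poly_Mapping.lookup g n / (of_int k - \<alpha> - of_int n)" for n
    by (auto simp: f_def lookup_sum lookup_single when_def in_keys_iff)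
  then have "lscale (of_int k) f - V_action \<alpha> \<beta> f (witt_d 0) = g"
    using ne by (intro poly_mapping_eqI)
      (simp add: lookup_minus lookup_V_action_d0 field_simps)
  then show thesis by (rule that)
qed

text \<open>If a in A were x + y with x in the span of A - {a} and y in the span of B, then y = a -
  x would lie in both spans. Hence y = 0, and a would depend on the rest of A.\<close>

lemma (in vector_space) independent_Un:
  assumes "independent A" "independent B" and disj: "span A \<inter> span B = {0}"
  shows "independent (A \<union> B)"
proof -
  have *: "a \<notin> span (A \<union> B - {a})"
    if ind: "independent A" and disj: "span A \<inter> span B = {0}" and a: "a \<in> A" for a A B
  proof
    assume "a \<in> span (A \<union> B - {a})"
    then have "a \<in> span ((A - {a}) \<union> B)"
      using span_mono[of "A \<union> B - {a}" "(A - {a}) \<union> B"] by blast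
    then obtain x y where xy: "a = x + y" "x \<in> span (A - {a})" "y \<in> span B"
      unfolding span_Un by auto
    have "x \<in> span A" using xy(2) span_mono[of "A - {a}" A] by blast
    then have "y \<in> span A" using span_diff[OF span_base[OF a], of x] xy(1) by simp
    then have "y = 0" using disj xy(3) by blast
    then show False using ind a xy unfolding dependent_def by simp
  qed
  show ?thesis
    using *[OF assms(1) disj] *[of B A] assms(2) disj
    unfolding dependent_def by (auto simp: Un_commute Int_commute)
qed

text \<open>The bijection makes the target the direct sum of \<open>range f\<close> and
  \<open>range g\<close>, with both maps injective. Each carries a basis to a basis of its
  range.\<close>

lemma basis_family_case_sum:
  assumes f: "Vector_Spaces.linear s1 s f" and g: "Vector_Spaces.linear s2 s g"
    and bij: "bij (\<lambda>(x, y). f x + g y)"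
    and b1: "basis_family s1 b1" and b2: "basis_family s2 b2"
  shows "basis_family s (case_sum (f \<circ> b1) (g \<circ> b2))"
proof -
  interpret f: Vector_Spaces.linear s1 s f by (rule f)
  interpret g: Vector_Spaces.linear s2 s g by (rule g)
  have uniq: "x = x' \<and> y = y'" if "f x + g y = f x' + g y'" for x y x' y'
    using bij_is_inj[OF bij, THEN injD, of "(x, y)" "(x', y')"] that by simp
  have inj: "inj f" "inj g"
    using uniq[of _ 0 _ 0] uniq[of 0 _ 0] by (auto intro!: injI)
  have B: "f.vs1.independent (range b1)" "f.vs1.span (range b1) = UNIV" "inj b1"
    "g.vs1.independent (range b2)" "g.vs1.span (range b2) = UNIV" "inj b2"
    using b1 b2 by (auto simp: basis_family_def)
  have span: "f.vs2.span (range (f \<circ> b1)) = range f" "f.vs2.span (range (g \<circ> b2)) = range g"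
    using f.span_image[of "range b1"] g.span_image[of "range b2"] B by (simp_all add: image_comp)
  have disj: "range f \<inter> range g = {0}"
  proof -
    have "f x = 0" if "f x = g y" for x y
      using uniq[of x 0 0 y] that by simp
    moreover have "0 \<in> range f" "0 \<in> range g" by (metis f.zero g.zero rangeI)+
    ultimately show ?thesis by auto
  qed
  have range_Un: "range (case_sum (f \<circ> b1) (g \<circ> b2)) = range (f \<circ> b1) \<union> range (g \<circ> b2)"
    by (simp add: UNIV_sum image_Un image_image)
  have "f.vs2.independent (range (f \<circ> b1))" "f.vs2.independent (range (g \<circ> b2))"
    using f.independent_injective_image[of "range b1"] g.independent_injective_image[of "range b2"]
      B inj by (auto simp: image_comp inj_on_def)
  then have "f.vs2.independent (range (case_sum (f \<circ> b1) (g \<circ> b2)))"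
    unfolding range_Un by (rule f.vs2.independent_Un) (simp only: span disj)
  moreover have "f.vs2.span (range (case_sum (f \<circ> b1) (g \<circ> b2))) = UNIV"
    using bij_is_surj[OF bij] unfolding range_Un f.vs2.span_Un span by fastforce
  moreover have "inj (case_sum (f \<circ> b1) (g \<circ> b2))"
  proof -
    \<comment> \<open>The ranges of \<open>f\<close> and \<open>g\<close> share only 0, so nonzero
      basis vectors rule out a collision between the two halves of the family.\<close>
    have "b1 i \<noteq> 0" for i
      using B(1) f.vs1.dependent_zero by (metis rangeI)
    then have "f (b1 i) \<noteq> g y" for i y
      using uniq[of "b1 i" 0 0 y] by auto
    then show ?thesis
      using inj B(3,6) by (auto simp: inj_def split: sum.splits) metis
  qed
  ultimately show ?thesis by (simp add: basis_family_def)
qed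

theorem theorem2:
  fixes \<alpha> \<beta> :: complex
    and scale :: "complex \<Rightarrow> 'a::ab_group_add \<Rightarrow> 'a"
    and br :: "'a \<Rightarrow> 'a \<Rightarrow> 'a"
    and w :: "witt \<Rightarrow> 'a" and u :: "V_space \<Rightarrow> 'a"
  assumes "\<alpha> \<notin> \<int>"
    and "leibniz_algebra scale br"
    and "Vector_Spaces.linear witt_scale scale w" and "Vector_Spaces.linear lscale scale u"
    and "bij (\<lambda>(x, y). w x + u y)"
    and "range u = leibniz_kernel scale br"
    and "\<And>y x. br (u y) (w x) = u (V_action \<alpha> \<beta> y x)"
    and "\<And>x y. br (w x) (u y) = 0"
    and "\<And>y z. br (u y) (u z) = 0"
    and "\<And>x x'. br (w x) (w x') - w (witt_bracket x x') \<in> leibniz_kernel scale br"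
  shows "\<exists>(d :: int \<Rightarrow> 'a) (v :: int \<Rightarrow> 'a).
    basis_family scale (case_sum d v) \<and>
    (\<forall>k i. br (v k) (d i) = scale (of_int k + \<alpha> + \<beta> * of_int i) (v (i + k))) \<and>
    (\<forall>i j. br (d i) (d j) = scale (of_int (i - j)) (d (i + j))) \<and>
    (\<forall>i k. br (d i) (v k) = 0) \<and>
    (\<forall>k l. br (v k) (v l) = 0)"
proof -
  interpret L: leibniz_algebra scale br by fact
  interpret w: Vector_Spaces.linear witt_scale scale w by fact
  interpret u: Vector_Spaces.linear lscale scale u by fact
  interpret br_left: Vector_Spaces.linear scale scale "\<lambda>x. br x y" for y by (rule L.linear_br_left)
  interpret br_right: Vector_Spaces.linear scale scale "br x" for x by (rule L.linear_br_right)
  interpret WV: vector_space_pair witt_scale lscale ..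
  have "\<exists>g. br (w (witt_d i)) (w (witt_d 0)) = scale (of_int i) (w (witt_d i)) + u g" for i
  proof -
    obtain g where "br (w (witt_d i)) (w (witt_d 0)) - w (witt_bracket (witt_d i) (witt_d 0)) = u g"
      using assms(10)[of "witt_d i" "witt_d 0"] unfolding assms(6)[symmetric] by blast
    then show ?thesis by (auto simp: witt_bracket_d w.scale algebra_simps)
  qed
  then obtain g where
    g: "br (w (witt_d i)) (w (witt_d 0)) = scale (of_int i) (w (witt_d i)) + u (g i)" for i
    by metis
  have "\<forall>i. \<exists>h. lscale (of_int i) h - V_action \<alpha> \<beta> h (witt_d 0) = g i"
    using V_action_d0_minus_int_surj[OF assms(1)] by blast
  from choice[OF this] obtain f where
    f: "lscale (of_int i) (f i) - V_action \<alpha> \<beta> (f i) (witt_d 0) = g i" for i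
    by blast
  have indep: "witt.independent (range witt_d)" and inj: "inj witt_d"
    using basis_family_witt_d by (auto simp: basis_family_def)
  \<comment> \<open>The corrections \<open>f i\<close> are extended linearly to all of
    \<open>witt\<close>, so that the corrected lift \<open>w'\<close> is again a linear map and
    \<open>basis_family_case_sum\<close> applies to it.\<close>
  obtain F where F: "Vector_Spaces.linear witt_scale lscale F"
    and "\<forall>x\<in>range witt_d. F x = f (inv witt_d x)"
    using WV.linear_independent_extend[OF indep, of "f \<circ> inv witt_d"] by auto
  then have Fd: "F (witt_d i) = f i" for i using inj by simp
  interpret F: Vector_Spaces.linear witt_scale lscale F by (rule F)
  define w' where "w' x = w x + u (F x)" for x
  have w': "Vector_Spaces.linear witt_scale scale w'"
    by (simp add: Vector_Spaces.linear_iff w'_def w.add u.add F.add w.scale u.scale F.scale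
        L.scale_right_distrib witt.vector_space_axioms L.vector_space_axioms)
  interpret w': Vector_Spaces.linear witt_scale scale w' by (rule w')
  \<comment> \<open>Passing from \<open>w\<close> to \<open>w'\<close> is a shear along the kernel,
    with inverse (x, y) \<mapsto> (x, y - F x).\<close>
  have bij': "bij (\<lambda>(x, y). w' x + u y)"
  proof -
    have "bij (\<lambda>(x, y). (x, F x + y))"
      by (rule bij_betw_byWitness[where f' = "\<lambda>(x, y). (x, y - F x)"]) auto
    from bij_comp[OF this assms(5)] show ?thesis
      by (simp add: w'_def u.add o_def case_prod_unfold add.assoc)
  qed
  have inj_u: "inj u"
  proof (rule injI)
    fix x y
    assume "u x = u y"
    then show "x = y" using bij_is_inj[OF assms(5), THEN injD, of "(0, x)" "(0, y)"] by simp
  qed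
  \<comment> \<open>The correction lies in the kernel, whose elements multiply each other to zero,
    so the action on the kernel is unchanged.\<close>
  have uw: "br (u y) (w' x) = u (V_action \<alpha> \<beta> y x)" for x y
    by (simp add: w'_def br_right.add assms(7,9))
  have wu: "br (w' x) (u y) = 0" for x y
    by (simp add: w'_def br_left.add assms(8,9))
  define d where "d i = w' (witt_d i)" for i
  define v where "v k = u (Poly_Mapping.single k 1)" for k
  have d0: "br (d i) (d 0) = scale (of_int i) (d i)" for i
  proof -
    have "br (d i) (d 0) = scale (of_int i) (w (witt_d i)) + u (g i + V_action \<alpha> \<beta> (f i) (witt_d 0))"
      using uw[of "f i" "witt_d 0"]
      by (simp add: d_def w'_def Fd br_left.add br_right.add g assms(8) u.add)
    \<comment> \<open>This is the equation that determined \<open>f i\<close>. The correction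
      \<open>f 0\<close> of \<open>d 0\<close> has no effect, since kernel elements annihilate from
      the right.\<close>
    also have "g i + V_action \<alpha> \<beta> (f i) (witt_d 0) = lscale (of_int i) (f i)"
      using f[of i] by (metis diff_add_cancel)
    finally show ?thesis by (simp add: d_def w'_def Fd u.scale L.scale_right_distrib)
  qed
  have dd: "br (d a) (d i) = scale (of_int (a - i)) (d (a + i))" for a i
  proof -
    obtain c where c: "br (w (witt_d a)) (w (witt_d i)) - w (witt_bracket (witt_d a) (witt_d i)) = u c"
      using assms(10)[of "witt_d a" "witt_d i"] unfolding assms(6)[symmetric] by blast
    \<comment> \<open>The defect pulled back along \<open>u\<close>: \<open>c\<close> is the defect
      of the original lift, the action term comes from correcting \<open>d a\<close>, and the
      subtracted term from replacing \<open>w\<close> by \<open>w'\<close> at index a + i.\<close>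
    define e where "e = c + V_action \<alpha> \<beta> (f a) (witt_d i) - lscale (of_int (a - i)) (f (a + i))"
    have X: "br (d a) (d i) = scale (of_int (a - i)) (d (a + i)) + u e"
    proof -
      have "br (w (witt_d a)) (w (witt_d i)) = scale (of_int (a - i)) (w (witt_d (a + i))) + u c"
        using c by (simp add: witt_bracket_d w.scale diff_eq_eq add.commute del: of_int_diff)
      then show ?thesis
        using uw[of "f a" "witt_d i"]
        by (simp add: d_def w'_def Fd br_left.add br_right.add assms(8) e_def u.add u.diff u.scale
            L.scale_right_distrib del: of_int_diff)
    qed
    have "br (d a) (br (d i) (d 0)) = br (br (d a) (d i)) (d 0) - br (br (d a) (d 0)) (d i)"
      by (rule L.leibniz_identity)
    \<comment> \<open>By \<open>d0\<close>, the left side of the identity contributes the factor i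
      and the last term on the right the factor a.\<close>
    then have "br (br (d a) (d i)) (d 0) = scale (of_int (a + i)) (br (d a) (d i))"
      by (simp add: d0 br_left.scale br_right.scale L.scale_left_distrib algebra_simps)
    \<comment> \<open>The multiple of \<open>d (a + i)\<close> in \<open>X\<close> already has
      eigenvalue a + i by \<open>d0\<close>, so it cancels and only the condition on
      \<open>e\<close> remains.\<close>
    then have "u (V_action \<alpha> \<beta> e (witt_d 0)) = scale (of_int (a + i)) (u e)"
      unfolding X using uw[of e "witt_d 0"]
      by (simp add: d_def[of 0, symmetric] br_left.add br_left.scale d0 L.scale_right_distrib mult.commute
          del: of_int_add of_int_diff)
    then have "V_action \<alpha> \<beta> e (witt_d 0) = lscale (of_int (a + i)) e"
      using inj_u by (simp add: inj_eq flip: u.scale)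
    then have "e = 0" by (rule V_action_d0_eigenvalue_not_int[OF assms(1)])
    then show ?thesis using X by (simp add: u.zero)
  qed
  have vd: "br (v k) (d i) = scale (of_int k + \<alpha> + \<beta> * of_int i) (v (i + k))" for k i
    by (simp only: v_def d_def uw V_action_basis u.scale add.commute[of \<alpha>] add.commute[of i])
  have "basis_family scale (case_sum d v)"
    using basis_family_case_sum[OF w' assms(4) bij' basis_family_witt_d basis_family_single]
    by (simp add: o_def d_def[abs_def] v_def[abs_def])
  moreover have "br (d i) (v k) = 0" "br (v k) (v l) = 0" for i k l
    by (simp_all add: d_def v_def wu assms(9))
  ultimately show ?thesis using vd dd by blast
qed

end
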